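(* Let $H\subset\mathcal P_{\mathrm{fin},0}(\mathbb N_0)$ be a divisor-closed submonoid. Let $S=\langle B\colon B\in H\rangle$ be the submonoid of $\mathbb N_0$ generated by $\bigcup_{B\in H}B$ and $T=\langle \mathrm{rev}(B)\colon B\in H\rangle$ the submonoid of $\mathbb N_0$ generated by $\bigcup_{B\in H}\mathrm{rev}(B)$. Then \[H=\mathcal P_{\mathrm{fin},0}(S)\cap \mathrm{rev}\big(\mathcal P_{\mathrm{fin},0}(T)\big).\] Moreover, there exists $A\in H$ with $S=\langle A\rangle$ and $T=\langle\mathrm{rev}(A)\rangle$, and for any such $A$ we have $H=[\![A]\!]$.
   Context: For an additive submonoid $S\subset\mathbb N_0$, $\mathcal P_{\mathrm{fin},0}(S)$ is the monoid of finite subsets of $S$ containing $0$ under set addition $A+B=\{a+b\colon a\in A,b\in B\}$ (identity $\{0\}$). For $A\subset\mathbb N_0$, $\langle A\rangle$ is the submonoid of $\mathbb N_0$ generated by $A$. For $B\in\mathcal P_{\mathrm{fin},0}(\mathbb N_0)$, $\mathrm{rev}(B)=\max B-B=\{\max B-b\colon b\in B\}$, and for a set $H$ of such sets, $\mathrm{rev}(H)=\{\mathrm{rev}(B)\colon B\in H\}$. In $\mathcal P_{\mathrm{fin},0}(\mathbb N_0)$, $B$ divides $D$ if $D=B+C$ for some $C\in\mathcal P_{\mathrm{fin},0}(\mathbb N_0)$; a submonoid $H$ is divisor-closed if it contains every divisor of each of its elements; and $[\![A]\!]=\{B\colon B\text{ divides }nA\text{ for some }n\in\mathbb N_0\}$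 is the smallest divisor-closed submonoid containing $A$, where $nA$ is the $n$-fold sumset $A+\dots+A$ and $0A=\{0\}$. *)

theory Defs
  imports "HOL-Algebra.Divisibility" "HOL-Library.Set_Algebras" "HOL.Hull"
begin

definition nat_add :: "nat monoid" where
  "nat_add = \<lparr>carrier = UNIV, mult = (+), one = 0\<rparr>"

definition gen_submonoid :: "nat set \<Rightarrow> nat set" where
  "gen_submonoid A = (\<lambda>S. submonoid S nat_add) hull A"

text \<open>The sum of two sets is the sumset, from \<^theory>\<open>HOL-Library.Set_Algebras\<close>.\<close>

definition Pfin0 :: "nat set \<Rightarrow> nat set monoid" where
  "Pfin0 S = \<lparr>carrier = {A. finite A \<and> A \<subseteq> S \<and> 0 \<in> A}, mult = (+), one = {0}\<rparr>"

definition reversal :: "nat set \<Rightarrow> nat set" where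
  "reversal B = (\<lambda>b. Max B - b) ` B"

definition divisor_closed_submonoid :: "nat set set \<Rightarrow> bool" where
  "divisor_closed_submonoid H \<longleftrightarrow>
     submonoid H (Pfin0 UNIV) \<and>
     (\<forall>D\<in>H. \<forall>B\<in>carrier (Pfin0 UNIV). B divides\<^bsub>Pfin0 UNIV\<^esub> D \<longrightarrow> B \<in> H)"

text \<open>Since the operation of \<^term>\<open>Pfin0 UNIV\<close> is set addition, its power
  \<open>A [^] n\<close> is the \<open>n\<close>-fold sumset, equal to \<open>{0}\<close> for \<open>n = 0\<close>.\<close>

definition divisor_closure :: "nat set \<Rightarrow> nat set set" where
  "divisor_closure A =
     {B \<in> carrier (Pfin0 UNIV). \<exists>n::nat. B divides\<^bsub>Pfin0 UNIV\<^esub> (A [^]\<^bsub>Pfin0 UNIV\<^esub> n)}"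

end

theory Submission
  imports Defs
begin

text \<open>
  The heart of the matter is that \<open>B\<close> divides some \<open>nA\<close> as soon as \<open>B \<subseteq> \<langle>A\<rangle>\<close> and
  \<open>rev(B) \<subseteq> \<langle>rev(A)\<rangle>\<close>. Let \<open>m = max A\<close> and choose \<open>k\<close> with \<open>B \<subseteq> kA\<close> and
  \<open>rev(B) \<subseteq> k rev(A)\<close>. Among any \<open>m\<close> summands from \<open>A\<close>, some nonempty block has a sum divisible
  by \<open>m\<close> (pigeonhole on partial sums) and can be replaced by copies of \<open>m\<close> and \<open>0\<close>. Hence for
  \<open>n \<ge> m + 2k\<close> every \<open>x \<in> nA\<close> has a representation with at least \<open>k\<close> summands \<open>0\<close>, so that
  \<open>x + B \<subseteq> nA\<close>, or with at least \<open>k\<close> summands \<open>m\<close>, so that \<open>x - max B + B \<subseteq> nA\<close>. Therefore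
  \<open>nA = B + C\<close> with \<open>C = {c. c + B \<subseteq> nA}\<close>.

  An \<open>A \<in> H\<close> with \<open>S = \<langle>A\<rangle>\<close> and \<open>T = \<langle>rev(A)\<rangle>\<close> exists because submonoids of \<open>\<nat>\<^sub>0\<close> are finitely
  generated and both \<open>B\<close> and \<open>rev(B)\<close> grow when a further summand is added to \<open>B\<close>.
\<close>

section \<open>Iterated sumsets\<close>

definition nfold :: "nat \<Rightarrow> nat set \<Rightarrow> nat set" where
  "nfold n A = A [^]\<^bsub>Pfin0 UNIV\<^esub> n"

lemma nfold_0: "nfold 0 A = {0}"
  by (simp add: nfold_def nat_pow_def Pfin0_def)

lemma nfold_Suc: "nfold (Suc n) A = nfold n A + A"
  by (simp add: nfold_def nat_pow_def Pfin0_def)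

lemma mem_nfold_iff:
  "x \<in> nfold n A \<longleftrightarrow> (\<exists>xs. set xs \<subseteq> A \<and> length xs = n \<and> sum_list xs = x)"
proof (induction n arbitrary: x)
  case 0
  then show ?case by (auto simp: nfold_0)
next
  case (Suc n)
  show ?case
  proof
    assume "x \<in> nfold (Suc n) A"
    then obtain y a where ya: "x = y + a" "y \<in> nfold n A" "a \<in> A"
      by (auto simp: nfold_Suc elim: set_plus_elim)
    then obtain xs where "set xs \<subseteq> A" "length xs = n" "sum_list xs = y"
      using Suc by blast
    with ya show "\<exists>xs. set xs \<subseteq> A \<and> length xs = Suc n \<and> sum_list xs = x"
      by (intro exI[of _ "a # xs"]) auto
  next
    assume "\<exists>xs. set xs \<subseteq> A \<and> length xs = Suc n \<and> sum_list xs = x"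
    then obtain a xs where "set (a # xs) \<subseteq> A" "length xs = n" "x = sum_list xs + a"
      by (auto simp: length_Suc_conv)
    with Suc show "x \<in> nfold (Suc n) A"
      by (auto simp: nfold_Suc intro!: set_plus_intro)
  qed
qed

lemma nfold_add:
  assumes "x \<in> nfold p A" "y \<in> nfold q A"
  shows "x + y \<in> nfold (p + q) A"
proof -
  obtain xs where "set xs \<subseteq> A" "length xs = p" "sum_list xs = x"
    using assms by (auto simp: mem_nfold_iff)
  moreover obtain ys where "set ys \<subseteq> A" "length ys = q" "sum_list ys = y"
    using assms by (auto simp: mem_nfold_iff)
  ultimately show ?thesis
    unfolding mem_nfold_iff by (intro exI[of _ "xs @ ys"]) auto
qed

lemma mult_mem_nfold:
  assumes "a \<in> A"
  shows "n * a \<in> nfold n A"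
  using assms unfolding mem_nfold_iff
  by (intro exI[of _ "replicate n a"]) (auto simp: sum_list_replicate)

lemma nfold_mono:
  assumes "0 \<in> A" "p \<le> q"
  shows "nfold p A \<subseteq> nfold q A"
proof
  fix x assume "x \<in> nfold p A"
  from nfold_add[OF this mult_mem_nfold[OF assms(1), of "q - p"]] assms(2)
  show "x \<in> nfold q A" by simp
qed

lemma finite_nfold: "finite A \<Longrightarrow> finite (nfold n A)"
  by (induction n) (auto simp: nfold_0 nfold_Suc finite_set_plus)

section \<open>Generated submonoids of the natural numbers\<close>

lemma gen_submonoid_eq: "gen_submonoid A = (\<Union>n. nfold n A)"
  unfolding gen_submonoid_def
proof (rule hull_unique)
  show "A \<subseteq> (\<Union>n. nfold n A)"
    using mult_mem_nfold[of _ A 1] by auto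
  show "submonoid (\<Union>n. nfold n A) nat_add"
    by (unfold_locales) (auto simp: nat_add_def nfold_0 intro: nfold_add exI[of _ 0])
next
  fix M assume M: "A \<subseteq> M" "submonoid M nat_add"
  have "nfold n A \<subseteq> M" for n
  proof (induction n)
    case 0
    then show ?case
      using submonoid.one_closed[OF M(2)] by (simp add: nfold_0 nat_add_def)
  next
    case (Suc n)
    then show ?case
      using M(1) submonoid.m_closed[OF M(2)]
      by (fastforce simp: nfold_Suc nat_add_def elim: set_plus_elim)
  qed
  then show "(\<Union>n. nfold n A) \<subseteq> M" by blast
qed

lemma gen_submonoid_superset: "A \<subseteq> gen_submonoid A"
  unfolding gen_submonoid_def by (rule hull_subset)

lemma gen_submonoid_mono: "A \<subseteq> B \<Longrightarrow> gen_submonoid A \<subseteq> gen_submonoid B"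
  unfolding gen_submonoid_def by (rule hull_mono)

lemma gen_submonoid_add:
  "x \<in> gen_submonoid A \<Longrightarrow> y \<in> gen_submonoid A \<Longrightarrow> x + y \<in> gen_submonoid A"
  unfolding gen_submonoid_eq using nfold_add by blast

lemma gen_submonoid_mult: "a \<in> A \<Longrightarrow> n * a \<in> gen_submonoid A"
  unfolding gen_submonoid_eq using mult_mem_nfold by blast

lemma gen_submonoid_least:
  assumes "A \<subseteq> gen_submonoid B"
  shows "gen_submonoid A \<subseteq> gen_submonoid B"
proof -
  have "nfold n A \<subseteq> gen_submonoid B" for n
  proof (induction n)
    case 0
    show ?case unfolding gen_submonoid_eq by (auto simp: nfold_0 intro: exI[of _ 0])
  next
    case (Suc n)
    then show ?case
      using assms gen_submonoid_add by (fastforce simp: nfold_Suc elim: set_plus_elim)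
  qed
  then show ?thesis by (auto simp: gen_submonoid_eq[of A])
qed

text \<open>Fix \<open>m > 0\<close> in \<open>U\<close>. Any \<open>u\<close> in \<open>U\<close>
  exceeds the least element of \<open>U\<close> in its residue class modulo \<open>m\<close> by a
  multiple of \<open>m\<close>, so \<open>m\<close> and these at most \<open>m\<close> least
  elements generate everything.\<close>

lemma gen_submonoid_finitely_generated:
  fixes U :: "nat set"
  obtains F where "finite F" "F \<subseteq> U" "gen_submonoid F = gen_submonoid U"
proof (cases "U \<subseteq> {0}")
  case True
  then show ?thesis using that[of U] finite_subset by blast
next
  case False
  then obtain m where m: "m \<in> U" "m > 0" by auto
  define least where "least r = (LEAST u. u \<in> U \<and> u mod m = r)" for r
  define F where "F = insert m (least ` ((\<lambda>u. u mod m) ` U))"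
  have least: "least (u mod m) \<in> U \<and> least (u mod m) mod m = u mod m" if "u \<in> U" for u
    unfolding least_def by (rule LeastI[of _ u]) (use that in auto)
  have least_le: "least (u mod m) \<le> u" if "u \<in> U" for u
    unfolding least_def by (rule Least_le) (use that in auto)
  have "finite ((\<lambda>u. u mod m) ` U)"
    by (rule finite_subset[of _ "{..<m}"]) (use m in auto)
  then have "finite F" by (simp add: F_def)
  moreover have FU: "F \<subseteq> U" using m least by (auto simp: F_def)
  moreover have "U \<subseteq> gen_submonoid F"
  proof
    fix u assume u: "u \<in> U"
    obtain q where "u = least (u mod m) + m * q"
      using least[OF u] least_le[OF u] by (metis mod_eq_nat1E)
    moreover have "least (u mod m) \<in> gen_submonoid F" "q * m \<in> gen_submonoid F"
      using gen_submonoid_superset[of F] gen_submonoid_mult[of m F q] u by (auto simp: F_def)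
    ultimately show "u \<in> gen_submonoid F"
      using gen_submonoid_add[of "least (u mod m)" F "q * m"] by (simp add: mult.commute)
  qed
  ultimately show ?thesis
    using that[of F] gen_submonoid_least[of U F] gen_submonoid_mono[OF FU] by blast
qed

section \<open>Reversal and its compatibility with sumsets\<close>

lemma Max_set_plus:
  fixes A B :: "nat set"
  assumes "finite A" "finite B" "A \<noteq> {}" "B \<noteq> {}"
  shows "Max (A + B) = Max A + Max B"
proof (rule Max_eqI)
  show "Max A + Max B \<in> A + B" using assms by (intro set_plus_intro Max_in)
qed (use assms in \<open>auto simp: finite_set_plus intro!: add_mono elim!: set_plus_elim\<close>)

lemma reversal_set_plus:
  assumes "finite A" "finite B" "A \<noteq> {}" "B \<noteq> {}"
  shows "reversal (A + B) = reversal A + reversal B"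
proof -
  have eq: "Max A + Max B - (a + b) = (Max A - a) + (Max B - b)" if "a \<in> A" "b \<in> B" for a b
    using that assms Max_ge[of A a] Max_ge[of B b] by linarith
  show ?thesis
    unfolding reversal_def Max_set_plus[OF assms]
    by (auto simp: eq elim!: set_plus_elim intro!: set_plus_intro)
      (metis eq image_eqI set_plus_intro)
qed

lemma zero_mem_reversal: "finite B \<Longrightarrow> B \<noteq> {} \<Longrightarrow> 0 \<in> reversal B"
  unfolding reversal_def by (rule image_eqI[of _ _ "Max B"]) auto

lemma Max_reversal:
  assumes "finite B" "0 \<in> B"
  shows "Max (reversal B) = Max B"
  using assms unfolding reversal_def by (intro Max_eqI) (auto intro: rev_image_eqI)

lemma reversal_reversal:
  assumes "finite B" "0 \<in> B"
  shows "reversal (reversal B) = B"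
proof -
  have "reversal (reversal B) = (\<lambda>b. Max B - (Max B - b)) ` B"
    unfolding reversal_def[of "reversal B"] Max_reversal[OF assms]
    by (simp add: reversal_def image_image)
  also have "\<dots> = (\<lambda>b. b) ` B"
    using assms Max_ge by (intro image_cong) auto
  finally show ?thesis by simp
qed

text \<open>Subtracting each summand \<open>Max A - a\<close> from \<open>Max A\<close> returns
  \<open>a\<close>, so \<open>n\<close> summands from \<open>reversal A\<close> become
  \<open>n\<close> summands from \<open>A\<close>. The bound on \<open>x\<close> ensures that the
  natural subtraction does not truncate.\<close>

lemma nfold_reversal:
  assumes "finite A" "A \<noteq> {}" "x \<in> nfold n (reversal A)"
  shows "x \<le> n * Max A \<and> n * Max A - x \<in> nfold n A"
  using assms(3)
proof (induction n arbitrary: x)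
  case 0
  then show ?case by (simp add: nfold_0)
next
  case (Suc n)
  then obtain y a where ya: "x = y + (Max A - a)" "y \<in> nfold n (reversal A)" "a \<in> A"
    by (auto simp: nfold_Suc reversal_def elim!: set_plus_elim)
  have a: "a \<le> Max A" using ya assms by simp
  have y: "y \<le> n * Max A" "n * Max A - y \<in> nfold n A" using Suc.IH[OF ya(2)] by auto
  have "Suc n * Max A - x = (n * Max A - y) + a" "x \<le> Suc n * Max A"
    using ya(1) a y(1) by (simp_all)
  moreover have "(n * Max A - y) + a \<in> nfold (Suc n) A"
    unfolding nfold_Suc using y(2) ya(3) by (rule set_plus_intro)
  ultimately show ?case by simp
qed

section \<open>Representations of elements of iterated sumsets\<close>

text \<open>Since \<open>0 \<in> A\<close>, the sets \<open>nfold k A\<close> increase with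
  \<open>k\<close>, and a finite set inside their union lies in one of them.\<close>

lemma subset_nfold_of_subset_gen:
  assumes "finite B" "0 \<in> A" "B \<subseteq> gen_submonoid A"
  obtains k where "B \<subseteq> nfold k A"
proof -
  have "\<exists>k. B \<subseteq> nfold k A"
    using assms(1,3)
  proof (induction B rule: finite_induct)
    case (insert b B)
    then obtain k l where "B \<subseteq> nfold k A" "b \<in> nfold l A"
      by (auto simp: gen_submonoid_eq)
    then show ?case
      using nfold_mono[OF assms(2), of k "k + l"] nfold_mono[OF assms(2), of l "k + l"]
      by (intro exI[of _ "k + l"]) auto
  qed auto
  then show ?thesis using that by blast
qed

text \<open>Two prefix sums agree modulo \<open>Max A\<close>, so the block between them sums to
  \<open>j * Max A\<close>. The \<open>r\<close> summands outside the block give \<open>y\<close>;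
  there are fewer than \<open>Max A\<close> of them because the block is nonempty.\<close>

lemma nfold_block:
  assumes "finite A" "Max A > 0" "x \<in> nfold (Max A) A"
  shows "\<exists>j r y. j + r \<le> Max A \<and> r < Max A \<and> x = j * Max A + y \<and> y \<in> nfold r A"
proof -
  define m where "m = Max A"
  obtain xs where xs: "set xs \<subseteq> A" "length xs = m" "sum_list xs = x"
    using assms(3) unfolding mem_nfold_iff m_def by blast
  \<comment> \<open>There are \<open>m + 1\<close> prefixes, the empty one included, for only
    \<open>m\<close> residues.\<close>
  define s where "s p = sum_list (take p xs) mod m" for p
  have "s ` {..m} \<subseteq> {..<m}" using assms(2) by (auto simp: s_def m_def)
  then have "card (s ` {..m}) \<le> m" using card_mono[of "{..<m}"] by fastforce
  then have "\<not> inj_on s {..m}" by (intro pigeonhole) simp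
  then obtain p q where pq: "p < q" "q \<le> m" "s p = s q"
    unfolding inj_on_def by (metis atMost_iff linorder_neqE_nat)
  define block where "block = drop p (take q xs)"
  have "take q xs = take p xs @ block"
    using pq unfolding block_def by (metis append_take_drop_id min.absorb1 less_imp_le take_take)
  then have split: "sum_list (take q xs) = sum_list (take p xs) + sum_list block"
    by simp
  then have "sum_list block mod m = 0"
    using pq(3) unfolding s_def by (metis add_diff_cancel_left' le_add1 mod_eq_dvd_iff_nat mod_0_imp_dvd dvd_imp_mod_0)
  then obtain j where j: "sum_list block = j * m" by (metis mod_0_imp_dvd dvdE mult.commute)
  have len: "length block = q - p" using pq xs by (simp add: block_def)
  have "set block \<subseteq> A" using xs(1) unfolding block_def by (meson in_set_dropD in_set_takeD subset_eq)
  \<comment> \<open>Entries are at most \<open>m\<close>, so \<open>j\<close> is at most the block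
    length: replacing the block by \<open>j\<close> copies of \<open>m\<close> never increases the
    number of summands.\<close>
  then have "sum_list block \<le> (\<Sum>_\<leftarrow>block. m)"
    using sum_list_mono[of block "\<lambda>x. x" "\<lambda>_. m"] Max_ge[OF assms(1)]
    unfolding m_def by (metis list.map_ident subset_eq)
  then have "j * m \<le> (q - p) * m" by (simp add: j len sum_list_triv)
  then have jle: "j \<le> q - p" using assms(2) by (simp add: m_def)
  define rest where "rest = take p xs @ drop q xs"
  have "sum_list xs = sum_list (take q xs) + sum_list (drop q xs)"
    by (metis append_take_drop_id sum_list_append)
  then have "x = j * m + sum_list rest" using xs(3) split j by (simp add: rest_def)
  moreover have "sum_list rest \<in> nfold (m - (q - p)) A"
    unfolding mem_nfold_iff
  proof (intro exI conjI)
    show "set rest \<subseteq> A" using xs(1) unfolding rest_def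
      by (auto dest: in_set_dropD in_set_takeD)
  qed (use xs(2) pq in \<open>auto simp: rest_def\<close>)
  moreover have "j + (m - (q - p)) \<le> m" "m - (q - p) < m" using jle pq by auto
  ultimately show ?thesis unfolding m_def by blast
qed

lemma nfold_normal_form:
  assumes "finite A" "Max A > 0" "x \<in> nfold n A"
  shows "\<exists>j r y. j + r \<le> n \<and> r < Max A \<and> x = j * Max A + y \<and> y \<in> nfold r A"
  using assms(3)
proof (induction n arbitrary: x)
  case 0
  then show ?case using assms(2) by (intro exI[of _ 0]) (auto simp: nfold_0)
next
  case (Suc n)
  then obtain x' a where x: "x = x' + a" "x' \<in> nfold n A" "a \<in> A"
    by (auto simp: nfold_Suc elim: set_plus_elim)
  then obtain j r y where jr: "j + r \<le> n" "r < Max A" "x' = j * Max A + y" "y \<in> nfold r A"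
    using Suc.IH by blast
  have ya: "y + a \<in> nfold (Suc r) A" using jr x by (auto simp: nfold_Suc)
  show ?case
  proof (cases "Suc r < Max A")
    case True
    then show ?thesis using jr x ya
      by (intro exI[of _ j] exI[of _ "Suc r"] exI[of _ "y + a"]) auto
  next
    case False
    then have r: "Suc r = Max A" using jr by simp
    obtain j' r' y' where "j' + r' \<le> Max A" "r' < Max A" "y + a = j' * Max A + y'"
      "y' \<in> nfold r' A"
      using nfold_block[OF assms(1,2)] ya r by metis
    then show ?thesis using jr x r
      by (intro exI[of _ "j + j'"] exI[of _ r'] exI[of _ y']) (auto simp: algebra_simps)
  qed
qed

text \<open>The translate of \<open>B\<close> by \<open>x - b\<close> lies in
  \<open>nfold n A\<close> and contains \<open>x\<close>. The witness \<open>b\<close> is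
  \<open>0\<close> or \<open>Max B\<close>, according to the number \<open>j\<close> of copies of
  \<open>Max A\<close> in the normal form of \<open>x\<close>.\<close>

lemma nfold_translate:
  assumes A: "finite A" "0 \<in> A" "Max A > 0" and B: "finite B" "0 \<in> B"
    and k: "B \<subseteq> nfold k A" "reversal B \<subseteq> nfold k (reversal A)"
    and n: "Max A + 2 * k \<le> n" and x: "x \<in> nfold n A"
  shows "\<exists>b\<in>B. b \<le> x \<and> (\<forall>b'\<in>B. x - b + b' \<in> nfold n A)"
proof -
  obtain j r y where jr: "j + r \<le> n" "r < Max A" "x = j * Max A + y" "y \<in> nfold r A"
    using nfold_normal_form[OF A(1,3) x] by blast
  have ne: "A \<noteq> {}" using A by auto
  have MaxA: "Max A \<in> A" using A ne by simp
  have MaxB: "Max B \<in> B" using B by (intro Max_in) auto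
  show ?thesis
  proof (cases "j < k")
    \<comment> \<open>Here \<open>j < k\<close> and \<open>r < Max A\<close> leave at least
      \<open>k\<close> of the \<open>n\<close> places free, enough for any element of
      \<open>B\<close>.\<close>
    case True
    have "x \<in> nfold (j + r) A"
      unfolding jr(3) by (intro nfold_add mult_mem_nfold MaxA jr)
    moreover have "j + r + k \<le> n" using True jr n by simp
    ultimately have "x + b' \<in> nfold n A" if "b' \<in> B" for b'
      using that k(1) nfold_add[of x "j + r" A b' k] nfold_mono[OF A(2)] by blast
    then show ?thesis using B by (intro bexI[of _ 0]) auto
  next
    \<comment> \<open>Now \<open>k\<close> copies of \<open>Max A\<close> can be traded for the
      \<open>k\<close> summands of \<open>k * Max A - (Max B - b')\<close>, which lowers
      \<open>x\<close> by exactly \<open>Max B - b'\<close>.\<close>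
    case False
    then obtain i where i: "j = k + i" by (metis le_Suc_ex not_less)
    have z: "i * Max A + y \<in> nfold (i + r) A"
      by (intro nfold_add mult_mem_nfold MaxA jr)
    have rev: "Max B - b' \<le> k * Max A \<and> k * Max A - (Max B - b') \<in> nfold k A"
      if "b' \<in> B" for b'
      using that k(2) by (intro nfold_reversal[OF A(1) ne]) (auto simp: reversal_def)
    have le: "Max B \<le> k * Max A" using rev[OF B(2)] by simp
    have "x - Max B + b' \<in> nfold n A" if b': "b' \<in> B" for b'
    proof -
      have "b' \<le> Max B" using b' B by simp
      then have "x - Max B + b' = i * Max A + y + (k * Max A - (Max B - b'))"
        using le rev[OF b'] by (simp add: jr(3) i algebra_simps)
      moreover have "i * Max A + y + (k * Max A - (Max B - b')) \<in> nfold (i + r + k) A"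
        using nfold_add[OF z] rev[OF b'] by blast
      moreover have "i + r + k \<le> n" using jr(1) i by simp
      ultimately show ?thesis using nfold_mono[OF A(2)] by fastforce
    qed
    moreover have "Max B \<le> x" using le by (simp add: jr(3) i algebra_simps)
    ultimately show ?thesis using MaxB by blast
  qed
qed

section \<open>The divisibility criterion\<close>

lemma divides_nfold:
  assumes A: "finite A" "0 \<in> A" and B: "finite B" "0 \<in> B"
    and gen: "B \<subseteq> gen_submonoid A" "reversal B \<subseteq> gen_submonoid (reversal A)"
  shows "\<exists>n. B divides\<^bsub>Pfin0 UNIV\<^esub> nfold n A"
proof -
  have rA: "0 \<in> reversal A" using A by (intro zero_mem_reversal) auto
  have frB: "finite (reversal B)" using B by (simp add: reversal_def)
  obtain k1 where k1: "B \<subseteq> nfold k1 A"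
    using subset_nfold_of_subset_gen[OF B(1) A(2) gen(1)] .
  obtain k2 where k2: "reversal B \<subseteq> nfold k2 (reversal A)"
    using subset_nfold_of_subset_gen[OF frB rA gen(2)] .
  define k where "k = k1 + k2"
  have k: "B \<subseteq> nfold k A" "reversal B \<subseteq> nfold k (reversal A)"
    using k1 k2 nfold_mono[OF A(2), of k1 k] nfold_mono[OF rA, of k2 k] by (auto simp: k_def)
  show ?thesis
  proof (cases "Max A > 0")
    \<comment> \<open>There is no positive modulus for the pigeonhole argument, but \<open>A\<close>
      and \<open>B\<close> both collapse to \<open>{0}\<close>.\<close>
    case False
    then have "a = 0" if "a \<in> A" for a using Max_ge[OF A(1) that] by simp
    then have "A = {0}" using A(2) by blast
    then have "nfold k A = {0}" by (induction k) (auto simp: nfold_0 nfold_Suc)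
    then have "B = {0}" using k B by auto
    then show ?thesis
      by (intro exI[of _ 0]) (auto simp: factor_def nfold_0 Pfin0_def intro!: exI[of _ "{0}"])
  next
    case True
    define n where "n = Max A + 2 * k"
    \<comment> \<open>This is the largest possible cofactor. It is finite because
      \<open>0 \<in> B\<close>, and contains \<open>0\<close> because
      \<open>B \<subseteq> nfold k A\<close> and \<open>k \<le> n\<close>.\<close>
    define C where "C = {c. \<forall>b\<in>B. c + b \<in> nfold n A}"
    have "C \<subseteq> nfold n A" using B(2) unfolding C_def by force
    then have "finite C" using finite_nfold[OF A(1)] finite_subset by blast
    moreover have "0 \<in> C"
      using k(1) nfold_mono[OF A(2), of k n] by (auto simp: C_def n_def)
    moreover have "nfold n A = B + C"
    proof
      show "B + C \<subseteq> nfold n A"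
        by (auto simp: C_def add.commute elim!: set_plus_elim)
      show "nfold n A \<subseteq> B + C"
      proof
        fix x assume "x \<in> nfold n A"
        then obtain b where "b \<in> B" "b \<le> x" "\<forall>b'\<in>B. x - b + b' \<in> nfold n A"
          using nfold_translate[OF A True B k, of n x] by (auto simp: n_def)
        then have "b + (x - b) \<in> B + C" by (intro set_plus_intro) (auto simp: C_def)
        then show "x \<in> B + C" using \<open>b \<le> x\<close> by simp
      qed
    qed
    ultimately show ?thesis
      unfolding factor_def by (intro exI[of _ n] bexI[of _ C]) (auto simp: Pfin0_def)
  qed
qed

section \<open>Directed families and the characterization of \<open>H\<close>\<close>

text \<open>Directedness merges the members covering single points into one. It is applied with
  \<open>f\<close> the identity and with \<open>f = reversal\<close>.\<close>

lemma finite_subset_directed_Union: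
  assumes "finite F" "F \<subseteq> (\<Union>B\<in>H. f B)" "H \<noteq> {}"
    and "\<And>B C. B \<in> H \<Longrightarrow> C \<in> H \<Longrightarrow> \<exists>D\<in>H. f B \<union> f C \<subseteq> f D"
  shows "\<exists>A\<in>H. F \<subseteq> f A"
  using assms(1,2)
proof (induction F rule: finite_induct)
  case empty
  then show ?case using assms(3) by blast
next
  case (insert x F)
  then obtain B C where "B \<in> H" "F \<subseteq> f B" "C \<in> H" "x \<in> f C" by auto
  then show ?case using assms(4)[of B C] by blast
qed

theorem theorem4p3:
  fixes H :: "nat set set" and S T :: "nat set"
  assumes "divisor_closed_submonoid H"
    and "S = gen_submonoid (\<Union>B\<in>H. B)"
    and "T = gen_submonoid (\<Union>B\<in>H. reversal B)"
  shows "H = carrier (Pfin0 S) \<inter> reversal ` carrier (Pfin0 T) \<and>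
    (\<exists>A\<in>H. S = gen_submonoid A \<and> T = gen_submonoid (reversal A)) \<and>
    (\<forall>A\<in>H. S = gen_submonoid A \<and> T = gen_submonoid (reversal A) \<longrightarrow> H = divisor_closure A)"
proof -
  let ?R = "carrier (Pfin0 S) \<inter> reversal ` carrier (Pfin0 T)"
  have sub: "submonoid H (Pfin0 UNIV)"
    and divcl: "\<And>D B. D \<in> H \<Longrightarrow> B \<in> carrier (Pfin0 UNIV) \<Longrightarrow> B divides\<^bsub>Pfin0 UNIV\<^esub> D \<Longrightarrow> B \<in> H"
    using assms(1) by (auto simp: divisor_closed_submonoid_def)
  have H: "finite B" "0 \<in> B" if "B \<in> H" for B
    using submonoid.subset[OF sub] that by (auto simp: Pfin0_def)
  have H0: "{0} \<in> H" using submonoid.one_closed[OF sub] by (simp add: Pfin0_def)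
  have Hadd: "B + C \<in> H" if "B \<in> H" "C \<in> H" for B C
    using submonoid.m_closed[OF sub that] by (simp add: Pfin0_def)
  \<comment> \<open>Adding a set that contains \<open>0\<close> only enlarges; this makes both
    families directed under set addition.\<close>
  have sub_add: "B \<subseteq> B + C" "C \<subseteq> B + C" if "0 \<in> B" "0 \<in> C" for B C :: "nat set"
    using set_plus_intro[of _ B 0 C] set_plus_intro[of 0 B _ C] that by auto
  have rev_add: "reversal B \<union> reversal C \<subseteq> reversal (B + C)" if "B \<in> H" "C \<in> H" for B C
  proof -
    have ne: "B \<noteq> {}" "C \<noteq> {}" using H that by auto
    show ?thesis
      using reversal_set_plus[OF H(1)[OF that(1)] H(1)[OF that(2)] ne]
        sub_add[of "reversal B" "reversal C"] zero_mem_reversal H that ne by simp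
  qed
  have H_le: "H \<subseteq> ?R"
  proof
    fix B assume B: "B \<in> H"
    have "B \<subseteq> S" "reversal B \<subseteq> T"
      using B gen_submonoid_superset[of "\<Union>B\<in>H. B"]
        gen_submonoid_superset[of "\<Union>B\<in>H. reversal B"] by (auto simp: assms(2,3))
    moreover have "0 \<in> reversal B" "finite (reversal B)"
      using H[OF B] zero_mem_reversal[of B] by (auto simp: reversal_def)
    ultimately show "B \<in> ?R"
      using H[OF B] reversal_reversal[OF H[OF B]]
      by (auto simp: Pfin0_def intro!: image_eqI[of B reversal "reversal B"])
  qed
  have R_le: "?R \<subseteq> divisor_closure A"
    if A: "A \<in> H" "S = gen_submonoid A" "T = gen_submonoid (reversal A)" for A
  proof
    fix B assume "B \<in> ?R"
    then obtain D where B: "finite B" "0 \<in> B" "B \<subseteq> S"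
      and D: "finite D" "0 \<in> D" "D \<subseteq> T" "B = reversal D"
      by (auto simp: Pfin0_def)
    \<comment> \<open>Reversal is an involution on finite sets containing \<open>0\<close>, so
      \<open>reversal B = D\<close>.\<close>
    then have "reversal B \<subseteq> T" by (simp add: reversal_reversal)
    then have "\<exists>n. B divides\<^bsub>Pfin0 UNIV\<^esub> nfold n A"
      using divides_nfold[OF H[OF A(1)] B(1,2)] B(3) A by simp
    then show "B \<in> divisor_closure A"
      using B by (auto simp: divisor_closure_def nfold_def Pfin0_def)
  qed
  have cl_le: "divisor_closure A \<subseteq> H" if "A \<in> H" for A
  proof -
    have "nfold n A \<in> H" for n
      by (induction n) (auto simp: nfold_0 nfold_Suc H0 intro: Hadd that)
    then show ?thesis using divcl unfolding divisor_closure_def nfold_def by blast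
  qed
  \<comment> \<open>The inclusions form a cycle from \<open>H\<close> through \<open>?R\<close> and
    \<open>divisor_closure A\<close> back to \<open>H\<close>, so a single such \<open>A\<close>
    also yields the formula for \<open>H\<close>.\<close>
  have closure: "H = ?R \<and> H = divisor_closure A"
    if "A \<in> H" "S = gen_submonoid A" "T = gen_submonoid (reversal A)" for A
    using H_le R_le[OF that] cl_le[OF that(1)] by blast
  have "\<exists>A\<in>H. S = gen_submonoid A \<and> T = gen_submonoid (reversal A)"
  proof -
    obtain F where F: "finite F" "F \<subseteq> (\<Union>B\<in>H. B)" "gen_submonoid F = S"
      using gen_submonoid_finitely_generated[of "\<Union>B\<in>H. B"] assms(2) by metis
    obtain G where G: "finite G" "G \<subseteq> (\<Union>B\<in>H. reversal B)" "gen_submonoid G = T"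
      using gen_submonoid_finitely_generated[of "\<Union>B\<in>H. reversal B"] assms(3) by metis
    have "\<exists>D\<in>H. B \<union> C \<subseteq> D" if "B \<in> H" "C \<in> H" for B C
      using Hadd[OF that] sub_add[OF H(2)[OF that(1)] H(2)[OF that(2)]] by blast
    then obtain A1 where A1: "A1 \<in> H" "F \<subseteq> A1"
      using finite_subset_directed_Union[of F "\<lambda>B. B" H] F(1,2) H0 by (metis empty_iff)
    have "\<exists>D\<in>H. reversal B \<union> reversal C \<subseteq> reversal D" if "B \<in> H" "C \<in> H" for B C
      using Hadd[OF that] rev_add[OF that] by blast
    then obtain A2 where A2: "A2 \<in> H" "G \<subseteq> reversal A2"
      using finite_subset_directed_Union[of G reversal H] G(1,2) H0 by (metis empty_iff)
    \<comment> \<open>The sum contains \<open>A1\<close> and its reversal contains that of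
      \<open>A2\<close>, so it captures the generators of \<open>S\<close> and \<open>T\<close>
      simultaneously.\<close>
    define A where "A = A1 + A2"
    have A: "A \<in> H" using A1 A2 Hadd by (simp add: A_def)
    have "F \<subseteq> A" "G \<subseteq> reversal A"
      using A1(2) A2(2) sub_add(1)[OF H(2)[OF A1(1)] H(2)[OF A2(1)]] rev_add[OF A1(1) A2(1)]
      unfolding A_def by blast+
    then have "S \<subseteq> gen_submonoid A" "T \<subseteq> gen_submonoid (reversal A)"
      using F(3) G(3) gen_submonoid_mono by blast+
    moreover have "gen_submonoid A \<subseteq> S" "gen_submonoid (reversal A) \<subseteq> T"
      unfolding assms(2,3) using A by (blast intro!: gen_submonoid_mono)+
    ultimately show ?thesis using A by blast
  qed
  with closure show ?thesis by blast
qed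

end
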